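(* Let $x,\lambda\in\mathbb{R}$ and $n\in\mathbb{N}$ ($n\ge 1$), and let $P_{n,\lambda}[x]$ be the $(n+1)\times(n+1)$ lower triangular matrix with entries $(P_{n,\lambda}[x])_{ij}=x^{(i-j)|\lambda}\binom{i-1}{j-1}$ for $1\le j\le i\le n+1$ and $0$ for $j>i$. Then the bidiagonal decomposition of $P_{n,\lambda}[x]$ is as follows (indices $1\le i,j\le n+1$). i) If $x\neq k\lambda$ for all $k=-n+1,\ldots,0,\ldots,n-1$, then $$\left(\mathcal{BD}(P_{n,\lambda}[x])\right)_{ij}=\begin{cases}1,& i=j,\\ x+(i-2j)\lambda,& i>j,\\ 0,& i<j.\end{cases}$$ ii) If $x=k\lambda$ for some $k\in\{0,\ldots,n-1\}$, then $$\left(\mathcal{BD}(P_{n,\lambda}[x])\right)_{ij}=\begin{cases}1,& i=j,\\ x+(i-2j)\lambda,& i>j,\ j\le k,\\ 0,& \text{otherwise}.\end{cases}$$ iii) If $x=-k\lambda$ for some $k\in\{0,\ldots,n-1\}$, then $$\left(\mathcal{BD}(P_{n,\lambda}[x])\right)_{ij}=\begin{cases}1,& i=j,\\ x+(i-2j)\lambda,& 0<i-j\le k,\\ 0,& \text{otherwise}.\end{cases}$$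
   Context: For real $x,\lambda$ and an integer $m\ge 0$, $x^{m|\lambda}:=x(x+\lambda)\cdots(x+(m-1)\lambda)$ if $m>0$, and $x^{0|\lambda}:=1$. Bidiagonal decomposition and the notation $\mathcal{BD}(A)$: for an $N\times N$ real matrix $A$, a bidiagonal decomposition is a factorization $$A=F_{N-1}F_{N-2}\cdots F_1\,D\,G_1\cdots G_{N-2}G_{N-1},$$ where $D=\mathrm{diag}(p_{11},\ldots,p_{NN})$; for each $i\in\{1,\ldots,N-1\}$, $F_i$ is the lower bidiagonal matrix with all diagonal entries equal to $1$ and whose subdiagonal entry in position $(r,r-1)$ is $0$ for $2\le r\le i$ and $m_{r,r-i}$ for $i+1\le r\le N$; and $G_i$ is the upper bidiagonal matrix with all diagonal entries equal to $1$ and whose superdiagonal entry in position $(r-1,r)$ is $0$ for $2\le r\le i$ and $\widetilde m_{r,r-i}$ for $i+1\le r\le N$. The data of the decomposition are stored in the $N\times N$ matrix $\mathcal{BD}(A)$ with $$(\mathcal{BD}(A))_{ij}=\begin{cases} m_{ij},& i>j,\\ \widetilde m_{ji},& i<j,\\ p_{ii},& i=j.\end{cases}$$ Thus a formula for $\mathcal{BD}(A)$ asserts that $A$ equals the product above with the indicated values of $m_{ij}$, $\widetilde m_{ij}$, $p_{ii}$. Here $N=n+1$. *)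

theory Defs
  imports Complex_Main "Jordan_Normal_Form.Matrix"
begin

text \<open>Matrix positions are counted from 0 in the library. All index formulas below are written
  with positions counted from 1; the next two functions are the only places where the shift
  takes place.\<close>

definition mat1 :: "nat \<Rightarrow> (nat \<Rightarrow> nat \<Rightarrow> real) \<Rightarrow> real mat" where
  "mat1 N f = mat N N (\<lambda>(i, j). f (i + 1) (j + 1))"

definition entry1 :: "real mat \<Rightarrow> nat \<Rightarrow> nat \<Rightarrow> real" where
  "entry1 A i j = A $$ (i - 1, j - 1)"

definition gen_power :: "real \<Rightarrow> nat \<Rightarrow> real \<Rightarrow> real" where
  "gen_power x m lam = (\<Prod>t<m. x + real t * lam)"

definition gen_pascal :: "nat \<Rightarrow> real \<Rightarrow> real \<Rightarrow> real mat" where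
  "gen_pascal n lam x = mat1 (n + 1) (\<lambda>i j.
     if j \<le> i then gen_power x (i - j) lam * real ((i - 1) choose (j - 1)) else 0)"

text \<open>In the factors below, \<open>B\<close> stores the data of the decomposition: its entries are
  \<open>m i j\<close> for \<open>i > j\<close>, \<open>p i i\<close> for \<open>i = j\<close>, and \<open>m' j i\<close> for \<open>i < j\<close>. In particular the entry
  \<open>m' r (r - i)\<close> of the upper factors sits at position \<open>(r - i, r)\<close> of \<open>B\<close>.\<close>

definition lower_factor :: "nat \<Rightarrow> real mat \<Rightarrow> nat \<Rightarrow> real mat" where
  "lower_factor N B i = mat1 N (\<lambda>r c.
     if r = c then 1
     else if r = c + 1 \<and> i + 1 \<le> r then entry1 B r (r - i)
     else 0)"

definition upper_factor :: "nat \<Rightarrow> real mat \<Rightarrow> nat \<Rightarrow> real mat" where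
  "upper_factor N B i = mat1 N (\<lambda>c r.
     if r = c then 1
     else if r = c + 1 \<and> i + 1 \<le> r then entry1 B (r - i) r
     else 0)"

definition diag_factor :: "nat \<Rightarrow> real mat \<Rightarrow> real mat" where
  "diag_factor N B = mat1 N (\<lambda>r c. if r = c then entry1 B r r else 0)"

definition mat_list_prod :: "nat \<Rightarrow> real mat list \<Rightarrow> real mat" where
  "mat_list_prod N As = foldr (*) As (1\<^sub>m N)"

text \<open>\<open>is_BD A B\<close>: the matrix \<open>B\<close> is a valid value of \<open>BD(A)\<close>, i.e. \<open>A\<close> is the product
  \<open>F (N-1) \<dots> F 1 * D * G 1 \<dots> G (N-1)\<close> of the factors with data \<open>B\<close>. This is a relation:
  a singular \<open>A\<close> or different placements of zeros may admit several \<open>B\<close>.\<close>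

definition is_BD :: "real mat \<Rightarrow> real mat \<Rightarrow> bool" where
  "is_BD A B \<longleftrightarrow> (let N = dim_row A in
     A \<in> carrier_mat N N \<and> B \<in> carrier_mat N N \<and>
     A = mat_list_prod N (map (lower_factor N B) (rev [1..<N]))
           * diag_factor N B
           * mat_list_prod N (map (upper_factor N B) [1..<N]))"

end

theory Submission
  imports Defs
begin

text \<open>
  After the factors \<open>F i, \<dots>, F 1\<close> have been multiplied, row \<open>r\<close> of the product is a row of
  a smaller generalized Pascal matrix with a shifted parameter: with \<open>s = r - i\<close> it is row \<open>r - s + 1\<close>
  of \<open>P[x - (s - 1) lam]\<close>, moved \<open>s - 1\<close> columns to the right (this is the intermediate
  matrix of Neville elimination). Multiplying by one more factor amounts to a Pascal type
  recurrence, which holds for every \<open>x\<close>. If \<open>x = k lam\<close>, the parameter at \<open>s = k + 1\<close> is 0, so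
  these rows are rows of the identity and the multipliers in columns beyond \<open>k\<close> can be dropped.
  If \<open>x = - k lam\<close>, the product is already complete after \<open>k\<close> factors.
\<close>

section \<open>Products of bidiagonal factors, with positions counted from 1\<close>

lemma mat1_carrier [simp]: "mat1 N f \<in> carrier_mat N N"
  and dim_row_mat1 [simp]: "dim_row (mat1 N f) = N"
  and dim_col_mat1 [simp]: "dim_col (mat1 N f) = N"
  by (auto simp: mat1_def)

lemma mat1_cong:
  assumes "\<And>i j. 1 \<le> i \<Longrightarrow> i \<le> N \<Longrightarrow> 1 \<le> j \<Longrightarrow> j \<le> N \<Longrightarrow> f i j = g i j"
  shows "mat1 N f = mat1 N g"
  by (rule eq_matI) (auto simp: mat1_def intro!: assms)

lemma entry1_mat1:
  assumes "1 \<le> i" "i \<le> N" "1 \<le> j" "j \<le> N"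
  shows "entry1 (mat1 N f) i j = f i j"
  using assms by (auto simp: entry1_def mat1_def)

lemma mat1_identity: "mat1 N (\<lambda>i j. of_bool (i = j)) = 1\<^sub>m N"
  by (rule eq_matI) (auto simp: mat1_def)

lemma mat1_mult: "mat1 N f * mat1 N g = mat1 N (\<lambda>i j. \<Sum>k = 1..N. f i k * g k j)"
proof -
  have "(\<Sum>k = 1..N. f i k * g k j) = (\<Sum>k = 0..<N. f i (Suc k) * g (Suc k) j)" for i j
    by (rule sum.reindex_bij_witness[of _ Suc "\<lambda>k. k - 1"]) auto
  then show ?thesis
    by (intro eq_matI) (auto simp: mat1_def scalar_prod_def)
qed

lemma lower_factor_mult:
  assumes "0 < i"
  shows "lower_factor N (mat1 N b) i * mat1 N q =
    mat1 N (\<lambda>r c. q r c + (if i < r then b r (r - i) * q (r - 1) c else 0))"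
proof -
  let ?f = "\<lambda>r c. if r = c then 1
    else if r = c + 1 \<and> i + 1 \<le> r then entry1 (mat1 N b) r (r - i) else 0"
  have "(\<Sum>k = 1..N. ?f r k * q k c) =
      q r c + (if i < r then b r (r - i) * q (r - 1) c else 0)"
    if r: "1 \<le> r" "r \<le> N" for r c
  proof -
    \<comment> \<open>Only columns \<open>r\<close> and \<open>r - 1\<close> of row \<open>r\<close>
      contribute. Since \<open>0 < i\<close>, the condition \<open>i < r\<close> puts
      \<open>r - 1\<close> into the summation range.\<close>
    have "(\<Sum>k = 1..N. ?f r k * q k c) =
        (\<Sum>k = 1..N. (if k = r then q r c else 0) +
          (if k = r - 1 then (if i < r then b r (r - i) * q (r - 1) c else 0) else 0))"
      using r \<open>0 < i\<close> by (intro sum.cong) (auto simp: entry1_mat1)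
    also have "\<dots> = q r c + (if i < r then b r (r - i) * q (r - 1) c else 0)"
      using r \<open>0 < i\<close> by (auto simp: sum.distrib)
    finally show ?thesis .
  qed
  then show ?thesis
    unfolding lower_factor_def mat1_mult by (intro mat1_cong)
qed

lemma mat_list_prod_upper_factor:
  assumes "\<And>i j. i < j \<Longrightarrow> b i j = 0" and "\<And>i. i \<in> set is \<Longrightarrow> 0 < i"
  shows "mat_list_prod N (map (upper_factor N (mat1 N b)) is) = 1\<^sub>m N"
proof -
  have "upper_factor N (mat1 N b) i = 1\<^sub>m N" if "i \<in> set is" for i
    unfolding upper_factor_def mat1_identity[symmetric]
    using assms that by (intro mat1_cong) (auto simp: entry1_mat1)
  then show ?thesis
    by (induction "is") (auto simp: mat_list_prod_def)
qed

text \<open>\<open>rev\<close> puts the factor of largest index leftmost, so the induction on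
  \<open>i\<close> multiplies by one new factor from the left, which is the row operation in the
  second assumption.\<close>

lemma mat_list_prod_lower_factor:
  assumes "\<And>r c. 1 \<le> r \<Longrightarrow> 1 \<le> c \<Longrightarrow> q 0 r c = of_bool (r = c)"
    and "\<And>i r c. 1 \<le> r \<Longrightarrow> 1 \<le> c \<Longrightarrow>
      q (Suc i) r c = q i r c + (if Suc i < r then b r (r - Suc i) * q i (r - 1) c else 0)"
  shows "mat_list_prod N (map (lower_factor N (mat1 N b)) (rev [1..<Suc i])) = mat1 N (q i)"
proof (induction i)
  case 0
  have "mat1 N (q 0) = 1\<^sub>m N"
    unfolding mat1_identity[symmetric] by (intro mat1_cong) (simp add: assms(1))
  then show ?case
    by (simp add: mat_list_prod_def)
next
  case (Suc i)
  have "mat_list_prod N (map (lower_factor N (mat1 N b)) (rev [1..<Suc (Suc i)])) =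
      lower_factor N (mat1 N b) (Suc i) * mat1 N (q i)"
    using Suc by (simp add: mat_list_prod_def)
  also have "\<dots> = mat1 N (q (Suc i))"
    by (subst lower_factor_mult) (auto intro!: mat1_cong simp: assms(2))
  finally show ?case .
qed

text \<open>The diagonal and upper factors are identities, so a decomposition is verified by
  guessing a closed form \<open>q i\<close> for the partial products \<open>F i * ... * F 1\<close>.
  Each case below only supplies its \<open>q\<close>.\<close>

lemma is_BD_unit_lower_triangular:
  assumes "N \<ge> 1"
    and b: "\<And>i. b i i = 1" "\<And>i j. i < j \<Longrightarrow> b i j = 0"
    and q: "\<And>r c. 1 \<le> r \<Longrightarrow> 1 \<le> c \<Longrightarrow> q 0 r c = of_bool (r = c)"
      "\<And>i r c. 1 \<le> r \<Longrightarrow> 1 \<le> c \<Longrightarrow>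
        q (Suc i) r c = q i r c + (if Suc i < r then b r (r - Suc i) * q i (r - 1) c else 0)"
    and A: "\<And>r c. 1 \<le> r \<Longrightarrow> r \<le> N \<Longrightarrow> 1 \<le> c \<Longrightarrow> c \<le> N \<Longrightarrow> q (N - 1) r c = a r c"
  shows "is_BD (mat1 N a) (mat1 N b)"
proof -
  have "diag_factor N (mat1 N b) = 1\<^sub>m N"
    unfolding diag_factor_def mat1_identity[symmetric]
    by (intro mat1_cong) (auto simp: entry1_mat1 b)
  moreover have "mat_list_prod N (map (upper_factor N (mat1 N b)) [1..<N]) = 1\<^sub>m N"
    using b by (intro mat_list_prod_upper_factor) auto
  moreover have "mat_list_prod N (map (lower_factor N (mat1 N b)) (rev [1..<N])) = mat1 N a"
  proof -
    have "mat_list_prod N (map (lower_factor N (mat1 N b)) (rev [1..<Suc (N - 1)])) =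
        mat1 N (q (N - 1))"
      using q by (rule mat_list_prod_lower_factor)
    also have "\<dots> = mat1 N a"
      using A by (rule mat1_cong)
    finally show ?thesis
      using \<open>N \<ge> 1\<close> by simp
  qed
  ultimately show ?thesis
    by (simp add: is_BD_def right_mult_one_mat[of _ N N])
qed

section \<open>Generalized powers and binomial coefficients\<close>

lemma gen_power_0 [simp]: "gen_power x 0 lam = 1"
  by (simp add: gen_power_def)

lemma gen_power_Suc: "gen_power x (Suc m) lam = gen_power x m lam * (x + real m * lam)"
  by (simp add: gen_power_def)

lemma gen_power_Suc_shift: "gen_power x (Suc m) lam = x * gen_power (x + lam) m lam"
  by (induction m) (simp_all add: gen_power_Suc algebra_simps)

text \<open>All terms share the factor \<open>gen_power y d lam\<close>. The remaining identity is
  linear in binomial coefficients and follows from Pascal's rule and the absorption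
  identity.\<close>

lemma gen_power_binomial_rec:
  "gen_power y (Suc d) lam * real (Suc i choose Suc d) =
    gen_power (y - lam) (Suc d) lam * real (i choose Suc d) +
    (y + real i * lam) * (gen_power y d lam * real (i choose d))"
proof -
  have "real (Suc d) * real (Suc i choose Suc d) = real (Suc i) * real (i choose d)"
    by (metis Suc_times_binomial_eq mult.commute of_nat_mult)
  then have *: "real d * real (Suc i choose Suc d) =
      real i * real (i choose d) - real (i choose Suc d)"
    by (simp add: algebra_simps)
  have "(y + real d * lam) * real (Suc i choose Suc d) =
      y * real (Suc i choose Suc d) + lam * (real d * real (Suc i choose Suc d))"
    by (simp add: algebra_simps)
  also have "\<dots> = (y - lam) * real (i choose Suc d) + (y + real i * lam) * real (i choose d)"
    unfolding * by (simp add: algebra_simps)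
  finally have **: "gen_power y d lam * ((y + real d * lam) * real (Suc i choose Suc d)) =
      gen_power y d lam *
        ((y - lam) * real (i choose Suc d) + (y + real i * lam) * real (i choose d))"
    by (rule arg_cong)
  have shift: "gen_power (y - lam) (Suc d) lam = (y - lam) * gen_power y d lam"
    by (simp add: gen_power_Suc_shift)
  from ** show ?thesis
    unfolding shift gen_power_Suc[of y] by (simp add: algebra_simps del: binomial_Suc_Suc)
qed

text \<open>At \<open>- real a * lam\<close> the generalized power is a falling factorial of
  \<open>a\<close> up to the factor \<open>(- lam) ^ d\<close>, so both sides are symmetric in
  \<open>a\<close> and \<open>b\<close>.\<close>

lemma gen_power_neg_binomial_commute:
  "gen_power (- real a * lam) d lam * real (b choose d) =
    gen_power (- real b * lam) d lam * real (a choose d)"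
proof -
  have *: "gen_power (- real a * lam) d lam = (- lam) ^ d * fact d * real (a choose d)" for a
  proof -
    have "gen_power (- real a * lam) d lam = (\<Prod>t<d. - lam * (real a - real t))"
      unfolding gen_power_def by (intro prod.cong) (auto simp: algebra_simps)
    also have "\<dots> = (- lam) ^ d * (\<Prod>t<d. real a - real t)"
      by (subst prod.distrib) simp
    finally show ?thesis
      by (simp add: binomial_gbinomial gbinomial_prod_rev atLeast0LessThan)
  qed
  show ?thesis
    unfolding * by simp
qed

section \<open>Intermediate matrices of Neville elimination\<close>

definition neville_entry :: "real \<Rightarrow> real \<Rightarrow> nat \<Rightarrow> nat \<Rightarrow> nat \<Rightarrow> real" where
  "neville_entry lam x i r c =
    (if c \<le> r then gen_power (x - (real r - real i - 1) * lam) (r - c) lam * real (i choose (r - c))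
     else 0)"

lemma neville_entry_0: "neville_entry lam x 0 r c = of_bool (r = c)"
  by (auto simp: neville_entry_def)

text \<open>With \<open>y\<close> the parameter of row \<open>r\<close> at step
  \<open>Suc i\<close>, row \<open>r - 1\<close> at step \<open>i\<close> also has parameter
  \<open>y\<close>, and row \<open>r\<close> at step \<open>i\<close> has \<open>y - lam\<close>.
  The coefficient is the multiplier in column \<open>r - Suc i\<close>.\<close>

lemma neville_entry_Suc:
  assumes "1 \<le> r"
  shows "neville_entry lam x (Suc i) r c = neville_entry lam x i r c +
    (x + (2 * real (Suc i) - real r) * lam) * neville_entry lam x i (r - 1) c"
proof (cases "c < r")
  case True
  then obtain d where d: "r = Suc (c + d)"
    using less_imp_Suc_add by auto
  show ?thesis
    using gen_power_binomial_rec[of "x - (real r - real (Suc i) - 1) * lam" d lam i]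
    by (simp add: neville_entry_def d algebra_simps del: binomial_Suc_Suc)
next
  case False
  then show ?thesis
    using assms by (auto simp: neville_entry_def)
qed

text \<open>Row \<open>r\<close> is complete after \<open>r - 1\<close> factors: the parameter shift
  is then 0.\<close>

lemma neville_entry_pascal:
  assumes "1 \<le> r" "1 \<le> c"
  shows "neville_entry lam x (r - 1) r c =
    (if c \<le> r then gen_power x (r - c) lam * real ((r - 1) choose (c - 1)) else 0)"
proof -
  have "(r - 1) choose (r - c) = (r - 1) choose (c - 1)" if "c \<le> r"
    using that assms binomial_symmetric[of "c - 1" "r - 1"] by simp
  then show ?thesis
    using assms by (simp add: neville_entry_def of_nat_diff)
qed

lemma neville_entry_zero_parameter:
  assumes "r = k + 1 + i"
  shows "neville_entry lam (real k * lam) i r c = of_bool (r = c)"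
proof -
  have "real r - real i - 1 = real k"
    using assms by simp
  then show ?thesis
    by (cases "r - c") (auto simp: neville_entry_def gen_power_Suc_shift)
qed

text \<open>The parameters at steps \<open>k\<close> and \<open>r - 1\<close> are
  \<open>- real (r - 1) * lam\<close> and \<open>- real k * lam\<close>, so the two entries are
  exchanged by the commutation of powers and binomials.\<close>

lemma neville_entry_stabilizes:
  assumes "1 \<le> r" "k < r"
  shows "neville_entry lam (- real k * lam) k r c = neville_entry lam (- real k * lam) (r - 1) r c"
proof -
  have "- real k * lam - (real r - real k - 1) * lam = - real (r - 1) * lam"
    using assms by (simp add: of_nat_diff algebra_simps)
  moreover have "- real k * lam - (real r - real (r - 1) - 1) * lam = - real k * lam"
    using assms by (simp add: of_nat_diff)
  ultimately show ?thesis
    using gen_power_neg_binomial_commute[of "r - 1" lam "r - c" k]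
    by (simp only: neville_entry_def)
qed

text \<open>Treats i) and iii) together: \<open>K = n\<close> gives the full lower triangle,
  \<open>K = k\<close> the band.\<close>

lemma is_BD_gen_pascal_band:
  assumes "n \<le> K \<or> x = - real K * lam"
  shows "is_BD (gen_pascal n lam x)
    (mat1 (n + 1) (\<lambda>i j. if i = j then 1
       else if j < i \<and> i - j \<le> K then x + (real i - 2 * real j) * lam else 0))"
  unfolding gen_pascal_def
proof (rule is_BD_unit_lower_triangular)
  \<comment> \<open>Row \<open>r\<close> is changed only by factors of index below \<open>r\<close>,
    and the multipliers of factors beyond \<open>K\<close> vanish; the step counter is frozen
    accordingly.\<close>
  let ?q = "\<lambda>i r. neville_entry lam x (min i (min K (r - 1))) r"
  show "?q 0 r c = of_bool (r = c)" for r c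
    by (simp add: neville_entry_0)
  show "?q (Suc i) r c = ?q i r c +
      (if Suc i < r then (if r = r - Suc i then 1
         else if r - Suc i < r \<and> r - (r - Suc i) \<le> K
           then x + (real r - 2 * real (r - Suc i)) * lam else 0) * ?q i (r - 1) c else 0)"
    if "1 \<le> r" for i r c
  proof (cases "Suc i < r \<and> Suc i \<le> K")
    case True
    then have "real r - 2 * real (r - Suc i) = 2 * real (Suc i) - real r"
      by (simp add: of_nat_diff)
    moreover have "min (Suc i) (min K (r - 1)) = Suc i" "min i (min K (r - 1)) = i"
        "min i (min K (r - 1 - 1)) = i" "r - (r - Suc i) = Suc i"
      using True by auto
    ultimately show ?thesis
      using True by (simp add: neville_entry_Suc[OF that])
  next
    case False
    then have "min (Suc i) (min K (r - 1)) = min i (min K (r - 1))"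
      by auto
    then show ?thesis
      using False by auto
  qed
  show "?q (n + 1 - 1) r c =
      (if c \<le> r then gen_power x (r - c) lam * real (r - 1 choose (c - 1)) else 0)"
    if r: "1 \<le> r" "r \<le> n + 1" "1 \<le> c" for r c
  proof (cases "r - 1 \<le> K")
    case True
    then have "min (n + 1 - 1) (min K (r - 1)) = r - 1"
      using r by simp
    then show ?thesis
      using r by (simp only: neville_entry_pascal)
  next
    case False
    then have "min (n + 1 - 1) (min K (r - 1)) = K" "x = - real K * lam" "K < r"
      using r assms by auto
    then show ?thesis
      using r by (simp only: neville_entry_stabilizes neville_entry_pascal)
  qed
qed auto

lemma is_BD_gen_pascal_columns:
  assumes "x = real k * lam"
  shows "is_BD (gen_pascal n lam x)
    (mat1 (n + 1) (\<lambda>i j. if i = j then 1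
       else if i > j \<and> j \<le> k then x + (real i - 2 * real j) * lam else 0))"
  unfolding gen_pascal_def
proof (rule is_BD_unit_lower_triangular)
  \<comment> \<open>Rows with \<open>r - i > k\<close> have met only dropped multipliers and are
    still identity rows. At \<open>r = k + 1 + i\<close> the parameter is 0 and both branches agree,
    which makes the recurrence work across the boundary.\<close>
  let ?q = "\<lambda>i r c. if r \<le> k + 1 + i then neville_entry lam x (min i (r - 1)) r c
    else of_bool (r = c)"
  show "?q 0 r c = of_bool (r = c)" for r c
    by (simp add: neville_entry_0)
  show "?q (Suc i) r c = ?q i r c +
      (if Suc i < r then (if r = r - Suc i then 1
         else if r > r - Suc i \<and> r - Suc i \<le> k
           then x + (real r - 2 * real (r - Suc i)) * lam else 0) * ?q i (r - 1) c else 0)"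
    if "1 \<le> r" for i r c
  proof -
    consider "r \<le> Suc i" | "Suc i < r" "r \<le> k + Suc i" | "Suc i < r" "r = k + 1 + Suc i"
      | "k + 1 + Suc i < r"
      by linarith
    then show ?thesis
    proof cases
      case 1
      then have "min (Suc i) (r - 1) = min i (r - 1)"
        by auto
      then show ?thesis
        using 1 by auto
    next
      case 2
      then have "real r - 2 * real (r - Suc i) = 2 * real (Suc i) - real r"
        by (simp add: of_nat_diff)
      moreover have "min (Suc i) (r - 1) = Suc i" "min i (r - 1) = i" "min i (r - 1 - 1) = i"
        "r - Suc i \<le> k" "r - 1 \<le> k + 1 + i" "r \<noteq> r - Suc i"
        using 2 by auto
      ultimately show ?thesis
        using 2 by (simp add: neville_entry_Suc[OF that])
    next
      case 3
      then show ?thesis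
        using neville_entry_zero_parameter[OF 3(2), of lam c] by (simp add: assms)
    next
      case 4
      then show ?thesis
        by auto
    qed
  qed
  show "?q (n + 1 - 1) r c =
      (if c \<le> r then gen_power x (r - c) lam * real (r - 1 choose (c - 1)) else 0)"
    if r: "1 \<le> r" "r \<le> n + 1" "1 \<le> c" for r c
  proof -
    have "min (n + 1 - 1) (r - 1) = r - 1" "r \<le> k + 1 + (n + 1 - 1)"
      using r by auto
    then show ?thesis
      using r by (simp only: neville_entry_pascal if_True)
  qed
qed auto

theorem theorem5:
  fixes x lam :: real and n :: nat
  assumes "n \<ge> 1"
  shows "((\<forall>k::int. - int n + 1 \<le> k \<and> k \<le> int n - 1 \<longrightarrow> x \<noteq> of_int k * lam) \<longrightarrow>
            is_BD (gen_pascal n lam x)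
              (mat1 (n + 1) (\<lambda>i j.
                 if i = j then 1
                 else if i > j then x + (real i - 2 * real j) * lam
                 else 0)))
       \<and> (\<forall>k::nat. k \<le> n - 1 \<and> x = real k * lam \<longrightarrow>
            is_BD (gen_pascal n lam x)
              (mat1 (n + 1) (\<lambda>i j.
                 if i = j then 1
                 else if i > j \<and> j \<le> k then x + (real i - 2 * real j) * lam
                 else 0)))
       \<and> (\<forall>k::nat. k \<le> n - 1 \<and> x = - real k * lam \<longrightarrow>
            is_BD (gen_pascal n lam x)
              (mat1 (n + 1) (\<lambda>i j.
                 if i = j then 1
                 else if 0 < int i - int j \<and> int i - int j \<le> int k
                      then x + (real i - 2 * real j) * lam
                 else 0)))"
proof (intro conjI allI impI)
  \<comment> \<open>Positions lie between 1 and \<open>n + 1\<close>, so a band of width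
    \<open>n\<close> is no restriction.\<close>
  have "mat1 (n + 1) (\<lambda>i j. if i = j then 1
        else if i > j then x + (real i - 2 * real j) * lam else 0) =
      mat1 (n + 1) (\<lambda>i j. if i = j then 1
        else if j < i \<and> i - j \<le> n then x + (real i - 2 * real j) * lam else 0)"
    by (rule mat1_cong) auto
  then show "is_BD (gen_pascal n lam x)
      (mat1 (n + 1) (\<lambda>i j. if i = j then 1
        else if i > j then x + (real i - 2 * real j) * lam else 0))"
    using is_BD_gen_pascal_band[of n n x lam] by simp
next
  fix k :: nat
  assume "k \<le> n - 1 \<and> x = real k * lam"
  then show "is_BD (gen_pascal n lam x)
      (mat1 (n + 1) (\<lambda>i j. if i = j then 1
        else if i > j \<and> j \<le> k then x + (real i - 2 * real j) * lam else 0))"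
    using is_BD_gen_pascal_columns by blast
next
  fix k :: nat
  assume k: "k \<le> n - 1 \<and> x = - real k * lam"
  have "0 < int i - int j \<and> int i - int j \<le> int k \<longleftrightarrow> j < i \<and> i - j \<le> k" for i j
    by auto
  then show "is_BD (gen_pascal n lam x)
      (mat1 (n + 1) (\<lambda>i j. if i = j then 1
        else if 0 < int i - int j \<and> int i - int j \<le> int k
          then x + (real i - 2 * real j) * lam else 0))"
    using is_BD_gen_pascal_band[of n k x lam] k by (simp only: simp_thms)
qed

end
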